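(* Suppose the model is deterministic and non-negative: $Y=f(\mathbf{X})$ with $f(\mathbf{x})\ge 0$ for all $\mathbf{x}$, and that $\eta_u>0$. Let $$q^*_{-u\mid u}(\mathbf{x}_{-u}\mid\mathbf{x}_u)=\frac{p_{-u\mid u}(\mathbf{x}_{-u}\mid\mathbf{x}_u)\,f(\mathbf{x})}{m(\mathbf{x}_u)},\qquad q_u^*(\mathbf{x}_u)=\frac{p_u(\mathbf{x}_u)\,m^2(\mathbf{x}_u)}{\eta_u},$$ so that the resulting joint sampling density is $$q^*(\mathbf{x})=q_u^*(\mathbf{x}_u)\,q^*_{-u\mid u}(\mathbf{x}_{-u}\mid\mathbf{x}_u)=\frac{p(\mathbf{x})\,f(\mathbf{x})\,m(\mathbf{x}_u)}{\eta_u}.$$ Then the optimal asymptotic variance for estimating $\eta_u$ under $q^*$ vanishes: $$\sigma^2_{\mathrm{opt},u}(q^* )=0.$$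
   Context: Setting. $\mathbf{X}=(X_1,\dots,X_k)$ is a random vector in $\mathbb{R}^k$, $f:\mathbb{R}^k\to\mathbb{R}$ is measurable and $Y=f(\mathbf{X})$ (no external noise). $\mathbb{E}_p$ denotes expectation when $\mathbf{X}$ has the reference Lebesgue density $p$ on $\mathbb{R}^k$ (components possibly dependent), and $\mathbb{E}_p[Y^2]<\infty$. Fix a nonempty $u\subseteq\{1,\dots,k\}$; $\mathbf{X}_u=(X_j)_{j\in u}$ and $\mathbf{X}_{-u}=(X_j)_{j\notin u}$. Densities are factorised as marginal times conditional, $p(\mathbf{x})=p_u(\mathbf{x}_u)\,p_{-u\mid u}(\mathbf{x}_{-u}\mid\mathbf{x}_u)$ and $q(\mathbf{x})=q_u(\mathbf{x}_u)\,q_{-u\mid u}(\mathbf{x}_{-u}\mid\mathbf{x}_u)$ (conditional factors are identically $1$ if $u=\{1,\dots,k\}$). Weights: $w_u(\mathbf{x}_u)=p_u(\mathbf{x}_u)/q_u(\mathbf{x}_u)$ and $w_{-u\mid u}(\mathbf{x}_{-u}\mid\mathbf{x}_u)=p_{-u\mid u}(\mathbf{x}_{-u}\mid\mathbf{x}_u)/q_{-u\mid u}(\mathbf{x}_{-u}\mid\mathbf{x}_u)$. Put $m(\mathbf{x}_u)=\mathbb{E}_p[Y\mid\mathbf{X}_u=\mathbf{x}_u]$ and $\eta_u=\mathbb{E}_p[m^2(\mathbf{X}_u)]$. The optimal asymptotic variance for estimating $\eta_u$ when sampling from $q$ is $$\sigma^2_{\mathrm{opt},u}(q)=\mathbb{E}_p\Big[w_u(\mathbf{X}_u)\Big(4\,m^2(\mathbf{X}_u)\,\mathbb{E}_p\big[w_{-u\mid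 u}(\mathbf{X}_{-u}\mid\mathbf{X}_u)\,Y^2\,\big|\,\mathbf{X}_u\big]-3\,m^4(\mathbf{X}_u)\Big)\Big]-\eta_u^2 .$$ Conventions: $0\cdot\infty=0$; where $m(\mathbf{x}_u)=0$, set $q^*_{-u\mid u}(\cdot\mid\mathbf{x}_u)=p_{-u\mid u}(\cdot\mid\mathbf{x}_u)$. *)

theory Defs
  imports "HOL-Probability.Probability"
begin

text \<open>A vector with components indexed by \<open>J\<close> is an extensional function on \<open>J\<close>.\<close>

abbreviation lebesgue_on_coords :: "nat set \<Rightarrow> (nat \<Rightarrow> real) measure" where
  "lebesgue_on_coords J \<equiv> (\<Pi>\<^sub>M j\<in>J. lborel)"

definition is_density :: "'a measure \<Rightarrow> ('a \<Rightarrow> real) \<Rightarrow> bool" where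
  "is_density N g \<longleftrightarrow>
     g \<in> borel_measurable N \<and> (AE x in N. 0 \<le> g x) \<and> (\<integral>\<^sup>+ x. ennreal (g x) \<partial>N) = 1"

text \<open>
  Factorisation \<open>g x = gu x\<^sub>u * gc x\<^sub>-\<^sub>u x\<^sub>u\<close> of a joint density into a marginal and a conditional
  one; \<open>gc b a\<close> stands for $g_{-u|u}(b | a)$.  As usual, a conditional density is constrained only
  at almost every value of the conditioning vector.  For \<open>u = {1..k}\<close> the space of the remaining
  coordinates is a single point of mass 1, so \<open>gc\<close> is then 1 at almost every value.
\<close>

definition density_factorisation ::
  "nat \<Rightarrow> nat set \<Rightarrow> ((nat \<Rightarrow> real) \<Rightarrow> real) \<Rightarrow> ((nat \<Rightarrow> real) \<Rightarrow> real)
    \<Rightarrow> ((nat \<Rightarrow> real) \<Rightarrow> (nat \<Rightarrow> real) \<Rightarrow> real) \<Rightarrow> bool" where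
  "density_factorisation k u g gu gc \<longleftrightarrow>
     is_density (lebesgue_on_coords {1..k}) g \<and>
     is_density (lebesgue_on_coords u) gu \<and>
     (\<lambda>(a, b). gc b a) \<in> borel_measurable (lebesgue_on_coords u \<Otimes>\<^sub>M lebesgue_on_coords ({1..k} - u)) \<and>
     (AE a in density (lebesgue_on_coords u) (\<lambda>a. ennreal (gu a)).
        is_density (lebesgue_on_coords ({1..k} - u)) (\<lambda>b. gc b a)) \<and>
     (\<forall>x \<in> space (lebesgue_on_coords {1..k}).
        g x = gu (restrict x u) * gc (restrict x ({1..k} - u)) (restrict x u))"

definition gen_by :: "'w measure \<Rightarrow> ('w \<Rightarrow> nat \<Rightarrow> real) \<Rightarrow> nat set \<Rightarrow> 'w measure" where
  "gen_by M X u = vimage_algebra (space M) (\<lambda>\<omega>. restrict (X \<omega>) u) (\<Pi>\<^sub>M j\<in>u. borel)"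

text \<open>\<open>m\<close> is a version of the regression function \<open>a \<mapsto> E[Y | X\<^sub>u = a]\<close>.\<close>

definition cond_exp_given ::
  "'w measure \<Rightarrow> ('w \<Rightarrow> nat \<Rightarrow> real) \<Rightarrow> nat set \<Rightarrow> ('w \<Rightarrow> real) \<Rightarrow> ((nat \<Rightarrow> real) \<Rightarrow> real) \<Rightarrow> bool" where
  "cond_exp_given M X u Y m \<longleftrightarrow>
     m \<in> borel_measurable (\<Pi>\<^sub>M j\<in>u. borel) \<and>
     (AE \<omega> in M. m (restrict (X \<omega>) u) = real_cond_exp M (gen_by M X u) Y \<omega>)"

text \<open>
  Expectation of an extended-real random variable, as the difference of the integrals of its
  positive and negative parts (\<open>e2ennreal\<close> sends negative values to 0).  Since \<open>\<infinity> - \<infinity> = \<infinity>\<close> in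
  \<^typ>\<open>ereal\<close>, a finite value is never an artefact of totalisation.
\<close>

definition ereal_expectation :: "'w measure \<Rightarrow> ('w \<Rightarrow> ereal) \<Rightarrow> ereal" where
  "ereal_expectation M Z =
     enn2ereal (\<integral>\<^sup>+ \<omega>. e2ennreal (Z \<omega>) \<partial>M) - enn2ereal (\<integral>\<^sup>+ \<omega>. e2ennreal (- Z \<omega>) \<partial>M)"

text \<open>In \<^typ>\<open>ennreal\<close>, \<open>r / 0 = \<infinity>\<close> for \<open>r > 0\<close>, \<open>0 / 0 = 0\<close> and \<open>0 * \<infinity> = 0\<close>.\<close>

definition weight :: "real \<Rightarrow> real \<Rightarrow> ennreal" where
  "weight r s = ennreal r / ennreal s"

definition eta :: "'w measure \<Rightarrow> ('w \<Rightarrow> nat \<Rightarrow> real) \<Rightarrow> nat set \<Rightarrow> ((nat \<Rightarrow> real) \<Rightarrow> real) \<Rightarrow> real" where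
  "eta M X u m = (\<integral>\<omega>. (m (restrict (X \<omega>) u))\<^sup>2 \<partial>M)"

text \<open>
  The sampling density enters through its factors \<open>qu\<close> and \<open>qc\<close>, the reference density (the law
  of \<open>X\<close> under \<open>M\<close>) through \<open>pu\<close> and \<open>pc\<close>.
\<close>

definition sigma2_opt ::
  "'w measure \<Rightarrow> ('w \<Rightarrow> nat \<Rightarrow> real) \<Rightarrow> nat \<Rightarrow> nat set \<Rightarrow> ('w \<Rightarrow> real) \<Rightarrow> ((nat \<Rightarrow> real) \<Rightarrow> real)
    \<Rightarrow> ((nat \<Rightarrow> real) \<Rightarrow> real) \<Rightarrow> ((nat \<Rightarrow> real) \<Rightarrow> (nat \<Rightarrow> real) \<Rightarrow> real)
    \<Rightarrow> ((nat \<Rightarrow> real) \<Rightarrow> real) \<Rightarrow> ((nat \<Rightarrow> real) \<Rightarrow> (nat \<Rightarrow> real) \<Rightarrow> real) \<Rightarrow> ereal" where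
  "sigma2_opt M X k u Y m pu pc qu qc =
    (let Xu = (\<lambda>\<omega>. restrict (X \<omega>) u);
         Xc = (\<lambda>\<omega>. restrict (X \<omega>) ({1..k} - u));
         wu = (\<lambda>\<omega>. weight (pu (Xu \<omega>)) (qu (Xu \<omega>)));
         wc = (\<lambda>\<omega>. weight (pc (Xc \<omega>) (Xu \<omega>)) (qc (Xc \<omega>) (Xu \<omega>)));
         C = nn_cond_exp M (gen_by M X u) (\<lambda>\<omega>. wc \<omega> * ennreal ((Y \<omega>)\<^sup>2))
     in ereal_expectation M
          (\<lambda>\<omega>. enn2ereal (wu \<omega>) *
               (4 * ereal ((m (Xu \<omega>))\<^sup>2) * enn2ereal (C \<omega>) - 3 * ereal ((m (Xu \<omega>)) ^ 4)))
        - ereal ((eta M X u m)\<^sup>2))"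

definition qstar_cond ::
  "nat \<Rightarrow> nat set \<Rightarrow> ((nat \<Rightarrow> real) \<Rightarrow> real) \<Rightarrow> ((nat \<Rightarrow> real) \<Rightarrow> real)
    \<Rightarrow> ((nat \<Rightarrow> real) \<Rightarrow> (nat \<Rightarrow> real) \<Rightarrow> real) \<Rightarrow> (nat \<Rightarrow> real) \<Rightarrow> (nat \<Rightarrow> real) \<Rightarrow> real" where
  "qstar_cond k u f m pc b a =
     (if m a = 0 then pc b a else pc b a * f (merge u ({1..k} - u) (a, b)) / m a)"

definition qstar_marg ::
  "real \<Rightarrow> ((nat \<Rightarrow> real) \<Rightarrow> real) \<Rightarrow> ((nat \<Rightarrow> real) \<Rightarrow> real) \<Rightarrow> (nat \<Rightarrow> real) \<Rightarrow> real" where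
  "qstar_marg \<eta> m pu a = pu a * (m a)\<^sup>2 / \<eta>"

end

theory Submission
  imports Defs
begin

text \<open>
  Sampling from \<open>q\<^sup>*\<close> makes both importance weights cancel everything that fluctuates.  Write
  \<open>a = x\<^sub>u\<close>, \<open>b = x\<^sub>-\<^sub>u\<close>.  Where \<open>m a > 0\<close>, the conditional weight is \<open>m a / f x\<close>, so
  \<open>w\<^sub>-\<^sub>u\<^sub>|\<^sub>u Y\<^sup>2 = m(X\<^sub>u) Y\<close>; its conditional expectation given \<open>X\<^sub>u\<close> is \<open>m\<^sup>2\<close>, and the
  bracket \<open>4 m\<^sup>2 E[w Y\<^sup>2 | X\<^sub>u] - 3 m\<^sup>4\<close> collapses to \<open>m\<^sup>4\<close>.  The marginal weight is
  \<open>\<eta> / m\<^sup>2\<close>, hence the integrand of the variance is \<open>\<eta> m\<^sup>2\<close>, whose expectation is \<open>\<eta>\<^sup>2\<close>.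

  The set \<open>{m = 0}\<close> need not be null, and there the marginal weight is infinite.  It multiplies a
  bracket that is exactly \<open>0\<close>, whatever the conditional expectation is.  Accordingly the conditional
  expectation is only computed after multiplication by the \<open>X\<^sub>u\<close>-measurable factor \<open>m\<^sup>2\<close>
  (\<open>AE_m_square_cond_exp\<close>), which makes the two sides agree trivially on \<open>{m = 0}\<close>; \<open>integrand_eq\<close>
  then covers both cases.

  That \<open>q\<^sup>*\<close> factorises into densities is a matter of normalisation.  The joint and the marginal factor
  have mass \<open>E[Y m(X\<^sub>u)] / \<eta> = E[m\<^sup>2(X\<^sub>u)] / \<eta> = 1\<close>.  For the conditional factor one needs that
  \<open>\<integral> p(b | a) f(a, b) db = m a\<close> for almost every \<open>a\<close>, whereas \<open>m\<close> is only known as a version of an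
  abstract conditional expectation.  The bridge is \<open>nn_cond_exp_disintegration\<close>: integrating against
  the conditional density is a version of conditional expectation given \<open>X\<^sub>u\<close>.
\<close>

section \<open>Conditional expectation of non-negative variables\<close>

text \<open>
  The truncation in \<^const>\<open>real_cond_exp\<close> loses nothing here: the negative part of \<open>Y\<close> contributes
  \<open>0\<close>, and the integral of the positive part is finite, so its conditional expectation is finite
  almost everywhere.
\<close>

lemma (in sigma_finite_subalgebra) ennreal_real_cond_exp:
  assumes int: "integrable M Y" and nonneg: "AE \<omega> in M. 0 \<le> Y \<omega>"
  shows "AE \<omega> in M. ennreal (real_cond_exp M F Y \<omega>) = nn_cond_exp M F (\<lambda>\<omega>. ennreal (Y \<omega>)) \<omega>"
    and "AE \<omega> in M. 0 \<le> real_cond_exp M F Y \<omega>"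
proof -
  have [measurable]: "Y \<in> borel_measurable M" using int by simp
  have "AE \<omega> in M. nn_cond_exp M F (\<lambda>\<omega>. ennreal (- Y \<omega>)) \<omega> = nn_cond_exp M F (\<lambda>\<omega>. 0) \<omega>"
    using nonneg by (intro nn_cond_exp_cong) (auto simp: ennreal_neg)
  moreover have "AE \<omega> in M. 0 = nn_cond_exp M F (\<lambda>\<omega>. 0) \<omega>"
    by (rule nn_cond_exp_F_meas) simp
  ultimately have neg: "AE \<omega> in M. nn_cond_exp M F (\<lambda>\<omega>. ennreal (- Y \<omega>)) \<omega> = 0"
    by auto
  have "(\<integral>\<^sup>+ \<omega>. nn_cond_exp M F (\<lambda>\<omega>. ennreal (Y \<omega>)) \<omega> \<partial>M) = (\<integral>\<^sup>+ \<omega>. ennreal (Y \<omega>) \<partial>M)"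
    using nn_cond_exp_intg[of "\<lambda>_. 1" "\<lambda>\<omega>. ennreal (Y \<omega>)"] by simp
  also have "\<dots> \<noteq> \<infinity>"
    using integrableD(2)[OF int] by simp
  finally have "AE \<omega> in M. nn_cond_exp M F (\<lambda>\<omega>. ennreal (Y \<omega>)) \<omega> \<noteq> \<infinity>"
    by (intro nn_integral_PInf_AE) auto
  with neg show "AE \<omega> in M. ennreal (real_cond_exp M F Y \<omega>)
      = nn_cond_exp M F (\<lambda>\<omega>. ennreal (Y \<omega>)) \<omega>"
    by eventually_elim (simp add: real_cond_exp_def less_top)
  from neg show "AE \<omega> in M. 0 \<le> real_cond_exp M F Y \<omega>"
    by eventually_elim (simp add: real_cond_exp_def)
qed

section \<open>Disintegration along a factorised density\<close>

lemma measurable_coords_lborel: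
  "g \<in> measurable (lebesgue_on_coords J) L \<longleftrightarrow> g \<in> measurable (\<Pi>\<^sub>M j\<in>J. borel) L"
proof -
  have "sets (lebesgue_on_coords J) = sets (\<Pi>\<^sub>M j\<in>J. borel)"
    by (intro sets_PiM_cong) auto
  then show ?thesis using measurable_cong_sets[OF _ refl, of "lebesgue_on_coords J"] by metis
qed

(* Keeps the index set {1..k} from being rewritten to {Suc 0..k}. *)
declare One_nat_def [simp del]

locale factorised_law = prob_space M for M :: "'w measure" +
  fixes X :: "'w \<Rightarrow> nat \<Rightarrow> real"
    and k :: nat and u :: "nat set"
    and p pu :: "(nat \<Rightarrow> real) \<Rightarrow> real"
    and pc :: "(nat \<Rightarrow> real) \<Rightarrow> (nat \<Rightarrow> real) \<Rightarrow> real"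
  assumes X_distributed: "distributed M (lebesgue_on_coords {1..k}) X (\<lambda>x. ennreal (p x))"
    and u_subset: "u \<subseteq> {1..k}"
    and factorisation: "density_factorisation k u p pu pc"
begin

abbreviation C where "C \<equiv> {1..k} - u"
abbreviation LX where "LX \<equiv> lebesgue_on_coords {1..k}"
abbreviation LU where "LU \<equiv> lebesgue_on_coords u"
abbreviation LC where "LC \<equiv> lebesgue_on_coords C"
abbreviation Xu where "Xu \<equiv> \<lambda>\<omega>. restrict (X \<omega>) u"
abbreviation Xc where "Xc \<equiv> \<lambda>\<omega>. restrict (X \<omega>) C"

sublocale coords: product_sigma_finite "\<lambda>_::nat. lborel :: real measure" ..

lemma C_simps [simp]: "u \<union> C = {1..k}" "u \<union> {1..k} = {1..k}" "u \<inter> C = {}" "finite u" "finite C"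
  using u_subset by (auto intro: finite_subset)

lemma X_measurable [measurable]: "X \<in> measurable M LX"
  using X_distributed by (rule distributed_measurable)

lemma restrict_measurable [measurable]:
  "(\<lambda>x. restrict x u) \<in> measurable LX LU" "(\<lambda>x. restrict x C) \<in> measurable LX LC"
  using u_subset by (auto intro: measurable_restrict_subset)

lemma Xu_measurable [measurable]: "Xu \<in> measurable M LU"
  using measurable_compose[OF X_measurable restrict_measurable(1)] .

lemma Xc_measurable [measurable]: "Xc \<in> measurable M LC"
  using measurable_compose[OF X_measurable restrict_measurable(2)] .

lemma merge_measurable [measurable]: "merge u C \<in> measurable (LU \<Otimes>\<^sub>M LC) LX"
  using measurable_merge[of u C "\<lambda>_. lborel"] by simp

lemma p_measurable [measurable]: "p \<in> borel_measurable LX"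
  and p_nonneg: "AE x in LX. 0 \<le> p x"
  and pu_measurable [measurable]: "pu \<in> borel_measurable LU"
  and pu_nonneg: "AE a in LU. 0 \<le> pu a"
  and pc_measurable': "(\<lambda>(a, b). pc b a) \<in> borel_measurable (LU \<Otimes>\<^sub>M LC)"
  and pc_density: "AE a in density LU (\<lambda>a. ennreal (pu a)). is_density LC (\<lambda>b. pc b a)"
  and p_eq: "x \<in> space LX \<Longrightarrow> p x = pu (restrict x u) * pc (restrict x C) (restrict x u)"
  using factorisation unfolding density_factorisation_def is_density_def by auto

lemma pc_measurable [measurable (raw)]:
  assumes "g \<in> measurable L LU" "h \<in> measurable L LC"
  shows "(\<lambda>x. pc (h x) (g x)) \<in> borel_measurable L"
  using measurable_compose[OF measurable_Pair[OF assms] pc_measurable'] by simp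

lemma LC_sigma_finite: "sigma_finite_measure LC"
  by (rule coords.sigma_finite) simp

lemma merge_in_space: "a \<in> space LU \<Longrightarrow> b \<in> space LC \<Longrightarrow> merge u C (a, b) \<in> space LX"
  using measurable_space[OF merge_measurable, of "(a, b)"] by (simp add: space_pair_measure)

lemma restrict_space:
  "a \<in> space LU \<Longrightarrow> restrict a u = a" "b \<in> space LC \<Longrightarrow> restrict b C = b"
  by (simp_all add: space_PiM PiE_def extensional_restrict)

lemma merge_restrict_coords: "x \<in> space LX \<Longrightarrow> merge u C (restrict x u, restrict x C) = x"
  by (simp add: space_PiM PiE_def extensional_restrict)

text \<open>
  Fubini for the splitting of the coordinates into \<open>u\<close> and its complement.  Every fact about the law
  of \<open>X\<^sub>u\<close> and about conditioning on it is extracted from this formula.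
\<close>

lemma nn_integral_factorised:
  assumes [measurable]: "g \<in> borel_measurable LX"
  shows "(\<integral>\<^sup>+ \<omega>. g (X \<omega>) \<partial>M)
    = (\<integral>\<^sup>+ a. ennreal (pu a) * (\<integral>\<^sup>+ b. ennreal (pc b a) * g (merge u C (a, b)) \<partial>LC) \<partial>LU)"
proof -
  have "(\<integral>\<^sup>+ \<omega>. g (X \<omega>) \<partial>M) = (\<integral>\<^sup>+ x. ennreal (p x) * g x \<partial>LX)"
    by (rule distributed_nn_integral[OF X_distributed, symmetric]) simp
  also have "\<dots> = (\<integral>\<^sup>+ a. (\<integral>\<^sup>+ b. ennreal (p (merge u C (a, b))) * g (merge u C (a, b)) \<partial>LC) \<partial>LU)"
    using coords.product_nn_integral_fold[of u C "\<lambda>x. ennreal (p x) * g x"] by simp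
  also have "\<dots> = (\<integral>\<^sup>+ a. ennreal (pu a) * (\<integral>\<^sup>+ b. ennreal (pc b a) * g (merge u C (a, b)) \<partial>LC) \<partial>LU)"
  proof (rule nn_integral_cong_AE, use pu_nonneg AE_space in eventually_elim)
    case (elim a)
    note [measurable] = measurable_Pair1'[OF elim(2)]
    have "(\<integral>\<^sup>+ b. ennreal (p (merge u C (a, b))) * g (merge u C (a, b)) \<partial>LC)
        = (\<integral>\<^sup>+ b. ennreal (pu a) * (ennreal (pc b a) * g (merge u C (a, b))) \<partial>LC)"
      using elim
      by (intro nn_integral_cong)
        (simp add: p_eq merge_in_space restrict_space ennreal_mult' mult.assoc)
    also have "\<dots> = ennreal (pu a) * (\<integral>\<^sup>+ b. ennreal (pc b a) * g (merge u C (a, b)) \<partial>LC)"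
      using elim by (intro nn_integral_cmult) measurable
    finally show ?case .
  qed
  finally show ?thesis .
qed

text \<open>
  In the disintegration formula applied to an event of \<open>X\<^sub>u\<close>, the inner integral is the mass of the
  conditional density.  This mass is \<open>1\<close> only where \<open>pu a > 0\<close>, which suffices because the outer
  integrand carries the factor \<open>pu a\<close>.
\<close>

lemma Xu_distributed: "distributed M LU Xu (\<lambda>a. ennreal (pu a))"
  unfolding distributed_def
proof (intro conjI measure_eqI)
  fix S assume "S \<in> sets (distr M LU Xu)"
  then have [measurable]: "S \<in> sets LU" by simp
  have "emeasure (distr M LU Xu) S = (\<integral>\<^sup>+ a. indicator S a \<partial>distr M LU Xu)"
    by simp
  also have "\<dots> = (\<integral>\<^sup>+ \<omega>. indicator S (Xu \<omega>) \<partial>M)"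
    by (rule nn_integral_distr) auto
  also have "\<dots> = (\<integral>\<^sup>+ a. ennreal (pu a) * (\<integral>\<^sup>+ b. ennreal (pc b a)
      * indicator S (restrict (merge u C (a, b)) u) \<partial>LC) \<partial>LU)"
    using nn_integral_factorised[of "\<lambda>x. indicator S (restrict x u)"] by simp
  also have "\<dots> = (\<integral>\<^sup>+ a. ennreal (pu a) * indicator S a \<partial>LU)"
  proof (rule nn_integral_cong_AE)
    have "AE a in LU. 0 < ennreal (pu a) \<longrightarrow> is_density LC (\<lambda>b. pc b a)"
      using pc_density by (subst (asm) AE_density) auto
    with AE_space show "AE a in LU. ennreal (pu a) * (\<integral>\<^sup>+ b. ennreal (pc b a)
      * indicator S (restrict (merge u C (a, b)) u) \<partial>LC) = ennreal (pu a) * indicator S a"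
    proof eventually_elim
      case (elim a)
      show ?case
      proof (cases "0 < ennreal (pu a)")
        case True
        with elim have "(\<integral>\<^sup>+ b. ennreal (pc b a) \<partial>LC) = 1" "(\<lambda>b. pc b a) \<in> borel_measurable LC"
          by (auto simp: is_density_def)
        then show ?thesis using elim(1) by (simp add: restrict_space nn_integral_multc)
      qed (simp add: ennreal_neg not_less)
    qed
  qed
  also have "\<dots> = emeasure (density LU (\<lambda>a. ennreal (pu a))) S"
    by (simp add: emeasure_density)
  finally show "emeasure (distr M LU Xu) S = emeasure (density LU (\<lambda>a. ennreal (pu a))) S" .
qed auto

lemma AE_pu_pos: "AE \<omega> in M. 0 < pu (Xu \<omega>)"
  using distributed_AE2[OF Xu_distributed, of "\<lambda>a. 0 < pu a"] by simp

lemma AE_pc_pos: "AE \<omega> in M. 0 < pc (Xc \<omega>) (Xu \<omega>)"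
proof -
  have "AE \<omega> in M. 0 < p (X \<omega>)"
    using distributed_AE2[OF X_distributed, of "\<lambda>x. 0 < p x"] by simp
  with AE_pu_pos AE_space show ?thesis
  proof eventually_elim
    case (elim \<omega>)
    with measurable_space[OF X_measurable] show ?case
      by (simp add: p_eq zero_less_mult_iff)
  qed
qed

abbreviation G where "G \<equiv> gen_by M X u"

lemma G_measurable: "Xu \<in> measurable G LU"
proof -
  have "Xu \<in> space M \<rightarrow> space (\<Pi>\<^sub>M j\<in>u. borel)"
    by (auto simp: space_PiM)
  then have "Xu \<in> measurable G (\<Pi>\<^sub>M j\<in>u. borel)"
    unfolding gen_by_def by (rule measurable_vimage_algebra1)
  also have "measurable G (\<Pi>\<^sub>M j\<in>u. borel) = measurable G LU"
    by (intro measurable_cong_sets sets_PiM_cong) auto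
  finally show ?thesis .
qed

lemma G_sets:
  assumes "D \<in> sets G"
  obtains S where "S \<in> sets LU" "D = Xu -` S \<inter> space M"
proof -
  have "Xu \<in> space M \<rightarrow> space (\<Pi>\<^sub>M j\<in>u. borel)"
    by (auto simp: space_PiM)
  moreover have "sets (\<Pi>\<^sub>M j\<in>u. borel) = sets LU"
    by (intro sets_PiM_cong) auto
  ultimately show ?thesis
    using assms that unfolding gen_by_def by (auto simp: sets_vimage_algebra2)
qed

lemma G_subalgebra: "subalgebra M G"
  unfolding subalgebra_def
proof
  show "space G = space M" by (simp add: gen_by_def)
  show "sets G \<subseteq> sets M"
    by (auto elim!: G_sets)
qed

sublocale cond: finite_measure_subalgebra M G
  by standard (rule G_subalgebra)

text \<open>
  An event of the \<open>\<sigma>\<close>-algebra generated by \<open>X\<^sub>u\<close> is of the form \<open>X\<^sub>u \<in> S\<close>.  Its indicator depends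
  on \<open>a\<close> alone, so it leaves the inner integral of \<open>nn_integral_factorised\<close>, and the defining
  identity of conditional expectation follows.
\<close>

lemma nn_cond_exp_disintegration:
  assumes [measurable]: "g \<in> borel_measurable LX"
  shows "AE \<omega> in M. (\<integral>\<^sup>+ b. ennreal (pc b (Xu \<omega>)) * g (merge u C (Xu \<omega>, b)) \<partial>LC)
    = nn_cond_exp M G (\<lambda>\<omega>. g (X \<omega>)) \<omega>"
proof -
  interpret LC: sigma_finite_measure LC by (rule LC_sigma_finite)
  define h where "h a = (\<integral>\<^sup>+ b. ennreal (pc b a) * g (merge u C (a, b)) \<partial>LC)" for a
  have [measurable]: "h \<in> borel_measurable LU"
    unfolding h_def by measurable
  have "AE \<omega> in M. h (Xu \<omega>) = nn_cond_exp M G (\<lambda>\<omega>. g (X \<omega>)) \<omega>"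
  proof (rule cond.nn_cond_exp_charact)
    show "(\<lambda>\<omega>. h (Xu \<omega>)) \<in> borel_measurable G"
      by (rule measurable_compose[OF G_measurable]) simp
    fix D assume "D \<in> sets G"
    then obtain S where [measurable]: "S \<in> sets LU" and D: "D = Xu -` S \<inter> space M"
      by (rule G_sets)
    have "(\<integral>\<^sup>+\<omega>\<in>D. g (X \<omega>) \<partial>M) = (\<integral>\<^sup>+ \<omega>. g (X \<omega>) * indicator S (Xu \<omega>) \<partial>M)"
      by (intro nn_integral_cong) (auto simp: D indicator_def)
    also have "\<dots> = (\<integral>\<^sup>+ a. ennreal (pu a) * (\<integral>\<^sup>+ b. ennreal (pc b a) *
        (g (merge u C (a, b)) * indicator S (restrict (merge u C (a, b)) u)) \<partial>LC) \<partial>LU)"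
      by (rule nn_integral_factorised) measurable
    also have "\<dots> = (\<integral>\<^sup>+ a. ennreal (pu a) * (h a * indicator S a) \<partial>LU)"
    proof (rule nn_integral_cong)
      fix a assume a: "a \<in> space LU"
      note [measurable] = measurable_Pair1'[OF a]
      have "(\<integral>\<^sup>+ b. (ennreal (pc b a) * g (merge u C (a, b))) * indicator S a \<partial>LC) = h a * indicator S a"
        unfolding h_def using a by (intro nn_integral_multc) measurable
      then show "ennreal (pu a) * (\<integral>\<^sup>+ b. ennreal (pc b a) *
        (g (merge u C (a, b)) * indicator S (restrict (merge u C (a, b)) u)) \<partial>LC)
        = ennreal (pu a) * (h a * indicator S a)"
        using a by (simp add: restrict_space mult.assoc)
    qed
    also have "\<dots> = (\<integral>\<^sup>+ \<omega>. h (Xu \<omega>) * indicator S (Xu \<omega>) \<partial>M)"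
      by (rule distributed_nn_integral[OF Xu_distributed]) measurable
    also have "\<dots> = (\<integral>\<^sup>+\<omega>\<in>D. h (Xu \<omega>) \<partial>M)"
      by (intro nn_integral_cong) (auto simp: D indicator_def)
    finally show "(\<integral>\<^sup>+\<omega>\<in>D. g (X \<omega>) \<partial>M) = (\<integral>\<^sup>+\<omega>\<in>D. h (Xu \<omega>) \<partial>M)" .
  qed measurable
  then show ?thesis by (simp add: h_def)
qed

end

section \<open>The optimal sampling density\<close>

locale nonneg_regression = factorised_law +
  fixes f m :: "(nat \<Rightarrow> real) \<Rightarrow> real"
  assumes f_borel: "f \<in> borel_measurable (\<Pi>\<^sub>M j\<in>{1..k}. borel)"
    and f_nonneg: "x \<in> space (\<Pi>\<^sub>M j\<in>{1..k}. (borel :: real measure)) \<Longrightarrow> 0 \<le> f x"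
    and square_integrable: "integrable M (\<lambda>\<omega>. (f (X \<omega>))\<^sup>2)"
    and regression: "cond_exp_given M X u (\<lambda>\<omega>. f (X \<omega>)) m"
    and eta_pos: "0 < eta M X u m"
begin

abbreviation \<eta> where "\<eta> \<equiv> eta M X u m"
abbreviation qu where "qu \<equiv> qstar_marg \<eta> m pu"
abbreviation qc where "qc \<equiv> qstar_cond k u f m pc"

lemma f_measurable [measurable]: "f \<in> borel_measurable LX"
  using f_borel by (simp add: measurable_coords_lborel)

lemma m_measurable [measurable]: "m \<in> borel_measurable LU"
  using regression by (simp add: cond_exp_given_def measurable_coords_lborel)

lemma f_nonneg': "x \<in> space LX \<Longrightarrow> 0 \<le> f x"
  using f_nonneg by (simp add: space_PiM)

lemma Y_nonneg: "\<omega> \<in> space M \<Longrightarrow> 0 \<le> f (X \<omega>)"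
  using measurable_space[OF X_measurable] by (rule f_nonneg')

lemma Y_integrable: "integrable M (\<lambda>\<omega>. f (X \<omega>))"
  by (rule square_integrable_imp_integrable[OF _ square_integrable]) measurable

lemma AE_m_nonneg: "AE \<omega> in M. 0 \<le> m (Xu \<omega>)"
  and AE_m_eq: "AE \<omega> in M. ennreal (m (Xu \<omega>)) = nn_cond_exp M G (\<lambda>\<omega>. ennreal (f (X \<omega>))) \<omega>"
proof -
  have "AE \<omega> in M. 0 \<le> f (X \<omega>)"
    using Y_nonneg by auto
  note * = cond.ennreal_real_cond_exp[OF Y_integrable this]
  have reg: "AE \<omega> in M. m (Xu \<omega>) = real_cond_exp M G (\<lambda>\<omega>. f (X \<omega>)) \<omega>"
    using regression by (simp add: cond_exp_given_def)
  from reg *(2) show "AE \<omega> in M. 0 \<le> m (Xu \<omega>)"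
    by eventually_elim simp
  from reg *(1) show "AE \<omega> in M. ennreal (m (Xu \<omega>)) = nn_cond_exp M G (\<lambda>\<omega>. ennreal (f (X \<omega>))) \<omega>"
    by eventually_elim simp
qed

text \<open>
  Both sides, evaluated at \<open>X\<^sub>u\<close>, are versions of the same conditional expectation; an almost sure
  identity in \<open>X\<^sub>u\<close> is one that holds almost everywhere for the law of \<open>X\<^sub>u\<close>.
\<close>

lemma AE_regression_integral:
  "AE a in density LU (\<lambda>a. ennreal (pu a)). 0 \<le> m a \<and>
     (\<integral>\<^sup>+ b. ennreal (pc b a) * ennreal (f (merge u C (a, b))) \<partial>LC) = ennreal (m a)"
proof -
  interpret LC: sigma_finite_measure LC by (rule LC_sigma_finite)
  define h where "h a = (\<integral>\<^sup>+ b. ennreal (pc b a) * ennreal (f (merge u C (a, b))) \<partial>LC)" for a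
  have [measurable]: "h \<in> borel_measurable LU"
    unfolding h_def by measurable
  have "AE \<omega> in M. (\<integral>\<^sup>+ b. ennreal (pc b (Xu \<omega>)) * ennreal (f (merge u C (Xu \<omega>, b))) \<partial>LC)
      = nn_cond_exp M G (\<lambda>\<omega>. ennreal (f (X \<omega>))) \<omega>"
    by (rule nn_cond_exp_disintegration) measurable
  with AE_m_nonneg AE_m_eq
  have "AE \<omega> in M. 0 \<le> m (Xu \<omega>) \<and>
      (\<integral>\<^sup>+ b. ennreal (pc b (Xu \<omega>)) * ennreal (f (merge u C (Xu \<omega>, b))) \<partial>LC) = ennreal (m (Xu \<omega>))"
    by eventually_elim simp
  then have "AE \<omega> in M. 0 \<le> m (Xu \<omega>) \<and> h (Xu \<omega>) = ennreal (m (Xu \<omega>))"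
    by (simp add: h_def)
  moreover have [measurable]: "Measurable.pred LU (\<lambda>a. h a = ennreal (m a))"
    unfolding pred_def by (rule borel_measurable_eq) measurable
  have "Measurable.pred LU (\<lambda>a. 0 \<le> m a \<and> h a = ennreal (m a))"
    by measurable
  ultimately have "AE a in LU. 0 < ennreal (pu a) \<longrightarrow> 0 \<le> m a \<and> h a = ennreal (m a)"
    using distributed_AE2[OF Xu_distributed, of "\<lambda>a. 0 \<le> m a \<and> h a = ennreal (m a)"] by blast
  then show ?thesis
    by (subst AE_density) (simp_all add: h_def)
qed

text \<open>A Bochner integral that does not exist is \<open>0\<close>, so \<open>\<eta> > 0\<close> already forces integrability.\<close>

lemma m_square_integrable: "integrable M (\<lambda>\<omega>. (m (Xu \<omega>))\<^sup>2)"
  using eta_pos not_integrable_integral_eq unfolding eta_def by fastforce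

lemma nn_integral_m_square: "(\<integral>\<^sup>+ \<omega>. ennreal ((m (Xu \<omega>))\<^sup>2) \<partial>M) = ennreal \<eta>"
  using nn_integral_eq_integral[OF m_square_integrable] by (simp add: eta_def)

text \<open>
  The version \<open>m\<close> may be negative on a set that the law of \<open>X\<^sub>u\<close> does not charge; there the factor
  \<open>p x\<close> vanishes almost everywhere.
\<close>

lemma qstar_joint_density:
  "is_density LX (\<lambda>x. p x * f x * m (restrict x u) / \<eta>)"
  unfolding is_density_def
proof (intro conjI)
  have "AE x in LX. 0 < ennreal (p x) \<longrightarrow> 0 \<le> m (restrict x u)"
    using AE_m_nonneg by (subst (asm) distributed_AE2[OF X_distributed]) auto
  with p_nonneg AE_space
  have AE_nonneg: "AE x in LX. 0 \<le> p x \<and> 0 \<le> f x \<and> (0 < p x \<longrightarrow> 0 \<le> m (restrict x u))"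
    by eventually_elim (simp add: f_nonneg')
  then show "AE x in LX. 0 \<le> p x * f x * m (restrict x u) / \<eta>"
    by eventually_elim
      (metis eta_pos divide_nonneg_pos mult_nonneg_nonneg mult_zero_left order_le_less div_0)
  have "(\<integral>\<^sup>+ x. ennreal (p x * f x * m (restrict x u) / \<eta>) \<partial>LX)
      = (\<integral>\<^sup>+ x. ennreal (p x) * (ennreal (m (restrict x u)) * ennreal (f x) / ennreal \<eta>) \<partial>LX)"
    using AE_nonneg
  proof (intro nn_integral_cong_AE, eventually_elim)
    case (elim x)
    show ?case
    proof (cases "p x = 0")
      case False
      with elim have "0 < p x" "0 \<le> f x" "0 \<le> m (restrict x u)"
        by auto
      then show ?thesis
        using eta_pos by (simp add: divide_ennreal mult_ac flip: ennreal_mult)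
    qed simp
  qed
  also have "\<dots> = (\<integral>\<^sup>+ \<omega>. ennreal (m (Xu \<omega>)) * ennreal (f (X \<omega>)) / ennreal \<eta> \<partial>M)"
    by (rule distributed_nn_integral[OF X_distributed]) measurable
  also have "\<dots> = (\<integral>\<^sup>+ \<omega>. ennreal (m (Xu \<omega>)) * ennreal (f (X \<omega>)) \<partial>M) / ennreal \<eta>"
    by (rule nn_integral_divide) measurable
  also have "(\<integral>\<^sup>+ \<omega>. ennreal (m (Xu \<omega>)) * ennreal (f (X \<omega>)) \<partial>M)
      = (\<integral>\<^sup>+ \<omega>. ennreal (m (Xu \<omega>)) * nn_cond_exp M G (\<lambda>\<omega>. ennreal (f (X \<omega>))) \<omega> \<partial>M)"
    by (rule cond.nn_cond_exp_intg[symmetric])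
      (auto intro!: measurable_compose[OF G_measurable])
  also have "\<dots> = (\<integral>\<^sup>+ \<omega>. ennreal ((m (Xu \<omega>))\<^sup>2) \<partial>M)"
    using AE_m_eq AE_m_nonneg
    by (intro nn_integral_cong_AE, eventually_elim)
      (metis ennreal_mult power2_eq_square)
  also have "\<dots> / ennreal \<eta> = 1"
    using eta_pos by (simp add: nn_integral_m_square divide_ennreal)
  finally show "(\<integral>\<^sup>+ x. ennreal (p x * f x * m (restrict x u) / \<eta>) \<partial>LX) = 1" .
qed measurable

lemma qstar_marg_density: "is_density LU qu"
  unfolding is_density_def
proof (intro conjI)
  show "qu \<in> borel_measurable LU"
    unfolding qstar_marg_def by measurable
  show "AE a in LU. 0 \<le> qu a"
    using pu_nonneg eta_pos by (auto simp: qstar_marg_def)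
  have "(\<integral>\<^sup>+ a. ennreal (qu a) \<partial>LU)
      = (\<integral>\<^sup>+ a. ennreal (pu a) * (ennreal ((m a)\<^sup>2) / ennreal \<eta>) \<partial>LU)"
    using pu_nonneg
    by (intro nn_integral_cong_AE, eventually_elim)
      (simp add: qstar_marg_def divide_ennreal eta_pos less_imp_le[OF eta_pos] flip: ennreal_mult)
  also have "\<dots> = (\<integral>\<^sup>+ \<omega>. ennreal ((m (Xu \<omega>))\<^sup>2) / ennreal \<eta> \<partial>M)"
    by (rule distributed_nn_integral[OF Xu_distributed]) measurable
  also have "\<dots> = (\<integral>\<^sup>+ \<omega>. ennreal ((m (Xu \<omega>))\<^sup>2) \<partial>M) / ennreal \<eta>"
    by (rule nn_integral_divide) measurable
  finally show "(\<integral>\<^sup>+ a. ennreal (qu a) \<partial>LU) = 1"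
    using eta_pos by (simp add: nn_integral_m_square divide_ennreal)
qed

lemma qc_measurable': "(\<lambda>(a, b). qc b a) \<in> borel_measurable (LU \<Otimes>\<^sub>M LC)"
  unfolding qstar_cond_def by measurable

lemma qc_measurable [measurable (raw)]:
  assumes "g \<in> measurable L LU" "h \<in> measurable L LC"
  shows "(\<lambda>x. qc (h x) (g x)) \<in> borel_measurable L"
  using measurable_compose[OF measurable_Pair[OF assms] qc_measurable'] by simp

text \<open>
  Almost every value for the law \<open>qu\<close> has \<open>pu a > 0\<close> and \<open>m a \<noteq> 0\<close>; there \<open>m a\<close> is the mass of
  \<open>pc b a * f x\<close>, that is, the normalising constant of the conditional factor.
\<close>

lemma qstar_cond_density:
  "AE a in density LU (\<lambda>a. ennreal (qu a)). is_density LC (\<lambda>b. qc b a)"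
proof -
  have [measurable]: "qu \<in> borel_measurable LU"
    unfolding qstar_marg_def by measurable
  have "AE a in LU. 0 < ennreal (pu a) \<longrightarrow> is_density LC (\<lambda>b. pc b a)"
    using pc_density by (subst (asm) AE_density) auto
  moreover have "AE a in LU. 0 < ennreal (pu a) \<longrightarrow> 0 \<le> m a \<and>
     (\<integral>\<^sup>+ b. ennreal (pc b a) * ennreal (f (merge u C (a, b))) \<partial>LC) = ennreal (m a)"
    using AE_regression_integral by (subst (asm) AE_density) auto
  ultimately have "AE a in LU. 0 < ennreal (qu a) \<longrightarrow> is_density LC (\<lambda>b. qc b a)"
    using pu_nonneg AE_space
  proof eventually_elim
    case (elim a)
    show ?case
    proof
      assume "0 < ennreal (qu a)"
      with elim eta_pos have pu: "0 < ennreal (pu a)" and "m a \<noteq> 0"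
        by (auto simp: qstar_marg_def zero_less_divide_iff zero_less_mult_iff)
      with elim have m: "0 < m a"
        and int: "(\<integral>\<^sup>+ b. ennreal (pc b a) * ennreal (f (merge u C (a, b))) \<partial>LC) = ennreal (m a)"
        and pc: "AE b in LC. 0 \<le> pc b a"
        by (auto simp: is_density_def)
      note [measurable] = measurable_Pair1'[OF elim(4)]
      have qc: "qc b a = pc b a * f (merge u C (a, b)) / m a" for b
        using m by (simp add: qstar_cond_def)
      have nonneg: "AE b in LC. 0 \<le> pc b a \<and> 0 \<le> f (merge u C (a, b))"
        using pc AE_space by eventually_elim (simp add: f_nonneg' merge_in_space elim)
      show "is_density LC (\<lambda>b. qc b a)"
        unfolding is_density_def
      proof (intro conjI)
        show "(\<lambda>b. qc b a) \<in> borel_measurable LC"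
          using elim by measurable
        show "AE b in LC. 0 \<le> qc b a"
          using nonneg by eventually_elim (simp add: qc m less_imp_le)
        have "(\<integral>\<^sup>+ b. ennreal (qc b a) \<partial>LC)
            = (\<integral>\<^sup>+ b. ennreal (pc b a) * ennreal (f (merge u C (a, b))) / ennreal (m a) \<partial>LC)"
          using nonneg
          by (intro nn_integral_cong_AE, eventually_elim)
            (simp add: qc divide_ennreal m flip: ennreal_mult)
        also have "\<dots> = ennreal (m a) / ennreal (m a)"
          using elim by (subst nn_integral_divide) (measurable, simp add: int)
        finally show "(\<integral>\<^sup>+ b. ennreal (qc b a) \<partial>LC) = 1"
          using m by (simp add: divide_ennreal)
      qed
    qed
  qed
  then show ?thesis by (simp add: AE_density)
qed

theorem qstar_factorisation:
  "density_factorisation k u (\<lambda>x. p x * f x * m (restrict x u) / \<eta>) qu qc"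
  unfolding density_factorisation_def
proof (intro conjI ballI)
  fix x assume x: "x \<in> space LX"
  show "p x * f x * m (restrict x u) / \<eta> = qu (restrict x u) * qc (restrict x C) (restrict x u)"
    using merge_restrict_coords[OF x]
    by (simp add: p_eq[OF x] qstar_marg_def qstar_cond_def power2_eq_square del: merge_restrict)
qed (rule qstar_joint_density qstar_marg_density qc_measurable' qstar_cond_density)+

section \<open>The asymptotic variance under the optimal density\<close>

text \<open>
  Where \<open>f\<close> vanishes the weight is infinite, but it is multiplied by \<open>Y\<^sup>2 = 0\<close>.
\<close>

lemma weight_qstar_cond:
  assumes "\<omega> \<in> space M" "0 < pc (Xc \<omega>) (Xu \<omega>)" "0 < m (Xu \<omega>)"
  shows "weight (pc (Xc \<omega>) (Xu \<omega>)) (qc (Xc \<omega>) (Xu \<omega>)) * ennreal ((f (X \<omega>))\<^sup>2)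
    = ennreal (m (Xu \<omega>) * f (X \<omega>))"
proof (cases "f (X \<omega>) = 0")
  case False
  then have "0 < f (X \<omega>)"
    using Y_nonneg[OF assms(1)] by simp
  moreover have "merge u C (Xu \<omega>, Xc \<omega>) = X \<omega>"
    using merge_restrict_coords measurable_space[OF X_measurable assms(1)] by blast
  ultimately show ?thesis
    using assms(2,3)
    by (simp add: weight_def qstar_cond_def divide_ennreal power2_eq_square del: merge_restrict merge_x_x_eq_restrict
        flip: ennreal_mult)
qed simp

text \<open>
  The factor \<open>m\<^sup>2\<close> moves into the conditional expectation, where \<open>m\<^sup>2 (w Y\<^sup>2) = m\<^sup>3 Y\<close> holds also
  on \<open>{m = 0}\<close>, and then \<open>m\<^sup>3\<close> moves out again and leaves \<open>E[Y | X\<^sub>u] = m\<close>.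
\<close>

lemma AE_m_square_cond_exp:
  "AE \<omega> in M. ennreal ((m (Xu \<omega>))\<^sup>2) * nn_cond_exp M G
      (\<lambda>\<omega>. weight (pc (Xc \<omega>) (Xu \<omega>)) (qc (Xc \<omega>) (Xu \<omega>)) * ennreal ((f (X \<omega>))\<^sup>2)) \<omega>
    = ennreal ((m (Xu \<omega>)) ^ 4)"
proof -
  define Z where "Z \<omega> = weight (pc (Xc \<omega>) (Xu \<omega>)) (qc (Xc \<omega>) (Xu \<omega>)) * ennreal ((f (X \<omega>))\<^sup>2)" for \<omega>
  have [measurable]: "Z \<in> borel_measurable M"
    unfolding Z_def weight_def by measurable
  have mG [measurable]: "(\<lambda>\<omega>. m (Xu \<omega>)) \<in> borel_measurable G"
    by (rule measurable_compose[OF G_measurable]) simp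
  have "AE \<omega> in M. ennreal ((m (Xu \<omega>))\<^sup>2) * nn_cond_exp M G Z \<omega>
      = nn_cond_exp M G (\<lambda>\<omega>. ennreal ((m (Xu \<omega>))\<^sup>2) * Z \<omega>) \<omega>"
    by (rule cond.nn_cond_exp_prod) measurable
  moreover have "AE \<omega> in M. nn_cond_exp M G (\<lambda>\<omega>. ennreal ((m (Xu \<omega>))\<^sup>2) * Z \<omega>) \<omega>
      = nn_cond_exp M G (\<lambda>\<omega>. ennreal ((m (Xu \<omega>)) ^ 3) * ennreal (f (X \<omega>))) \<omega>"
  proof (rule cond.nn_cond_exp_cong)
    show "AE \<omega> in M. ennreal ((m (Xu \<omega>))\<^sup>2) * Z \<omega> = ennreal ((m (Xu \<omega>)) ^ 3) * ennreal (f (X \<omega>))"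
      using AE_m_nonneg AE_pc_pos AE_space
    proof eventually_elim
      case (elim \<omega>)
      show ?case
      proof (cases "m (Xu \<omega>) = 0")
        case False
        with elim have "Z \<omega> = ennreal (m (Xu \<omega>) * f (X \<omega>))"
          unfolding Z_def by (intro weight_qstar_cond) auto
        with elim Y_nonneg[OF elim(3)] show ?thesis
          by (simp add: power2_eq_square power3_eq_cube mult.assoc flip: ennreal_mult)
      qed simp
    qed
  qed measurable
  moreover have "AE \<omega> in M. ennreal ((m (Xu \<omega>)) ^ 3) * nn_cond_exp M G (\<lambda>\<omega>. ennreal (f (X \<omega>))) \<omega>
      = nn_cond_exp M G (\<lambda>\<omega>. ennreal ((m (Xu \<omega>)) ^ 3) * ennreal (f (X \<omega>))) \<omega>"
    by (rule cond.nn_cond_exp_prod) measurable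
  ultimately have "AE \<omega> in M. ennreal ((m (Xu \<omega>))\<^sup>2) * nn_cond_exp M G Z \<omega> = ennreal ((m (Xu \<omega>)) ^ 4)"
    using AE_m_eq AE_m_nonneg
  proof eventually_elim
    case (elim \<omega>)
    then have "ennreal ((m (Xu \<omega>))\<^sup>2) * nn_cond_exp M G Z \<omega>
        = ennreal ((m (Xu \<omega>)) ^ 3) * ennreal (m (Xu \<omega>))"
      by simp
    also have "\<dots> = ennreal ((m (Xu \<omega>)) ^ 4)"
      using \<open>0 \<le> m (Xu \<omega>)\<close> by (simp add: power3_eq_cube power4_eq_xxxx flip: ennreal_mult)
    finally show ?case .
  qed
  then show ?thesis by (simp add: Z_def[abs_def])
qed

text \<open>
  The pointwise integrand, with \<open>r\<close>, \<open>s\<close>, \<open>c\<close> in the roles of \<open>pu\<close>, \<open>m\<close> and the conditional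
  expectation.  For \<open>s = 0\<close> the value of \<open>c\<close> is arbitrary, possibly infinite: the second factor is
  \<open>0\<close> by \<open>0 * \<infinity> = 0\<close>, and so is its product with the infinite weight.
\<close>

lemma integrand_eq:
  fixes c :: ennreal and r s :: real
  assumes r: "0 < r" and s: "0 \<le> s" and c: "ennreal (s\<^sup>2) * c = ennreal (s ^ 4)"
  shows "enn2ereal (weight r (r * s\<^sup>2 / \<eta>)) * (4 * ereal (s\<^sup>2) * enn2ereal c - 3 * ereal (s ^ 4))
    = ereal (\<eta> * s\<^sup>2)"
proof (cases "s = 0")
  case True
  then show ?thesis by (simp add: zero_ereal_def[symmetric])
next
  case False
  with s have s: "0 < s" by simp
  have "ennreal (s\<^sup>2) * c = ennreal (s\<^sup>2) * ennreal (s\<^sup>2)"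
    using c by (simp add: power2_eq_square power4_eq_xxxx mult.assoc flip: ennreal_mult)
  then have "c = ennreal (s\<^sup>2)"
    using s by (simp add: ennreal_mult_cancel_left)
  moreover have "weight r (r * s\<^sup>2 / \<eta>) = ennreal (\<eta> / s\<^sup>2)"
    using r s eta_pos by (simp add: weight_def divide_ennreal)
  ultimately show ?thesis
    using s eta_pos by (simp add: power2_eq_square power4_eq_xxxx field_simps)
qed

theorem sigma2_opt_qstar: "sigma2_opt M X k u (\<lambda>\<omega>. f (X \<omega>)) m pu pc qu qc = 0"
proof -
  define Z where "Z \<omega> = enn2ereal (weight (pu (Xu \<omega>)) (qu (Xu \<omega>))) *
    (4 * ereal ((m (Xu \<omega>))\<^sup>2) * enn2ereal (nn_cond_exp M G
      (\<lambda>\<omega>. weight (pc (Xc \<omega>) (Xu \<omega>)) (qc (Xc \<omega>) (Xu \<omega>)) * ennreal ((f (X \<omega>))\<^sup>2)) \<omega>)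
      - 3 * ereal ((m (Xu \<omega>)) ^ 4))" for \<omega>
  have Z: "AE \<omega> in M. Z \<omega> = ereal (\<eta> * (m (Xu \<omega>))\<^sup>2)"
    using AE_pu_pos AE_m_nonneg AE_m_square_cond_exp
  proof eventually_elim
    case (elim \<omega>)
    then show ?case
      unfolding Z_def qstar_marg_def by (rule integrand_eq)
  qed
  have "(\<integral>\<^sup>+ \<omega>. e2ennreal (Z \<omega>) \<partial>M) = (\<integral>\<^sup>+ \<omega>. ennreal \<eta> * ennreal ((m (Xu \<omega>))\<^sup>2) \<partial>M)"
    using Z
    by (intro nn_integral_cong_AE, eventually_elim) (simp add: eta_pos less_imp_le flip: ennreal_mult)
  also have "\<dots> = ennreal (\<eta>\<^sup>2)"
    using eta_pos
    by (subst nn_integral_cmult) (simp_all add: nn_integral_m_square power2_eq_square[of \<eta>] ennreal_mult)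
  finally have pos: "(\<integral>\<^sup>+ \<omega>. e2ennreal (Z \<omega>) \<partial>M) = ennreal (\<eta>\<^sup>2)" .
  have "(\<integral>\<^sup>+ \<omega>. e2ennreal (- Z \<omega>) \<partial>M) = (\<integral>\<^sup>+ \<omega>. 0 \<partial>M)"
    using Z
    by (intro nn_integral_cong_AE, eventually_elim) (simp add: ennreal_neg eta_pos less_imp_le)
  then have "ereal_expectation M Z = ereal (\<eta>\<^sup>2)"
    unfolding ereal_expectation_def pos by (simp add: zero_ennreal.rep_eq)
  then show ?thesis
    unfolding sigma2_opt_def Let_def Z_def[abs_def] by simp
qed

end

theorem mainTheorem4:
  fixes M :: "'w measure"
    and X :: "'w \<Rightarrow> nat \<Rightarrow> real"
    and k :: nat and u :: "nat set"
    and f p pu m :: "(nat \<Rightarrow> real) \<Rightarrow> real"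
    and pc :: "(nat \<Rightarrow> real) \<Rightarrow> (nat \<Rightarrow> real) \<Rightarrow> real"
  defines "Y \<equiv> (\<lambda>\<omega>. f (X \<omega>))"
    and "\<eta> \<equiv> eta M X u m"
  assumes "prob_space M"
    and "distributed M (lebesgue_on_coords {1..k}) X (\<lambda>x. ennreal (p x))"
    and "u \<noteq> {}" and "u \<subseteq> {1..k}"
    and "density_factorisation k u p pu pc"
    and "f \<in> borel_measurable (\<Pi>\<^sub>M j\<in>{1..k}. borel)"
    and "\<And>x. x \<in> space (\<Pi>\<^sub>M j\<in>{1..k}. (borel :: real measure)) \<Longrightarrow> 0 \<le> f x"
    and "integrable M (\<lambda>\<omega>. (Y \<omega>)\<^sup>2)"
    and "cond_exp_given M X u Y m"
    and "\<eta> > 0"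
  shows "density_factorisation k u
           (\<lambda>x. p x * f x * m (restrict x u) / \<eta>)
           (qstar_marg \<eta> m pu) (qstar_cond k u f m pc)
         \<and> sigma2_opt M X k u Y m pu pc (qstar_marg \<eta> m pu) (qstar_cond k u f m pc) = 0"
proof -
  interpret prob_space M by fact
  interpret nonneg_regression M X k u p pu pc f m
    by unfold_locales (use assms in \<open>simp_all add: Y_def \<eta>_def\<close>)
  show ?thesis
    unfolding Y_def \<eta>_def using qstar_factorisation sigma2_opt_qstar by simp
qed

end
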